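(* Consider the $A_2$ $T$-system $$T_{1,j,k+1}T_{1,j,k-1}=T_{1,j+1,k}T_{1,j-1,k}+T_{2,j,k},\qquad T_{2,j,k+1}T_{2,j,k-1}=T_{2,j+1,k}T_{2,j-1,k}+T_{1,j,k}$$ on the points $(\alpha,j,k)$, $\alpha\in\{1,2\}$, $\alpha+j+k$ even, with boundary condition $T_{\alpha,j,k_{\alpha,j}}=a_{\alpha,j}$ along an admissible boundary $(k_{\alpha,j})$ (see context), the $T_{\alpha,j,k}$ being viewed as rational functions of the boundary values. Let $(1,j,k)$ satisfy $1+j+k$ even and $k>k_{1,j}$, and set $$j_0=\max\{j'\in\mathbb Z:\ j'-k_{1,j'}=j-k\},\qquad j_1=\min\{j'\in\mathbb Z:\ j'+k_{1,j'}=j+k\}.$$ Then, for any admissible choices of diagonals in the construction of the slice matrices, $$T_{1,j,k}=T_{1,j_1,k_{1,j_1}}\,\big(S_{j_0}S_{j_0+1}\cdots S_{j_1-1}\big)_{1,1}.$$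
   Context: Admissible boundary: integers $k_{\alpha,j}$ ($\alpha\in\{1,2\}$, $j\in\mathbb Z$) with $\alpha+j+k_{\alpha,j}$ even, $|k_{2,j}-k_{1,j}|=1$ and $|k_{\alpha,j+1}-k_{\alpha,j}|=1$ for all $j$, and which agree with the basic staircase up to a global shift outside a finite window: there are an even integer $c$ and integers $J_-\le J_+$ such that $k_{\alpha,j}=c+((\alpha+j)\bmod 2)$ whenever $j<J_-$ or $j>J_+$. Elementary matrices ($3\times 3$, indices $1,2,3$): $H_{\alpha,\alpha+1}(a,b,u)$ is the identity matrix except that its $2\times2$ block in rows/columns $\alpha,\alpha+1$ is $\begin{pmatrix}1&0\\ u/b&a/b\end{pmatrix}$, and $V_{\alpha,\alpha+1}(x,a,b)$ is the identity except that this block is $\begin{pmatrix}a/b&x/b\\ 0&1\end{pmatrix}$. Slice matrix $S_t$ ($t\in\mathbb Z$): put $a_\alpha=T_{\alpha,t,k_{\alpha,t}}$, $b_\alpha=T_{\alpha,t+1,k_{\alpha,t+1}}$ for $\alpha=1,2$, and $a_0=b_0=a_3=b_3=1$. For the square $Q$ with corners $(1,t),(1,t+1),(2,t),(2,t+1)$, a diagonal is admissible if its two endpoints have equal $k$-values: "SW–NE" is $(1,t)$–$(2,t+1)$ (admissible iff $k_{1,t}=k_{2,t+1}$) and "NW–SE" is $(1,t+1)$–$(2,t)$ (admissible iff $k_{1,t+1}=k_{2,t}$); at least one is admissible, and one admissible diagonal is chosen. For $\alpha=1,2$: if $k_{\alpha,t+1}=k_{\alpha,t}+1$, set $X_\alpha=H_{\alpha,\alpha+1}(a_\alpha,b_\alpha,u_\alpha)$,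 where $u_2=1$ and $u_1=b_2$ if $Q$ has the SW–NE diagonal, $u_1=a_2$ if NW–SE; if $k_{\alpha,t+1}=k_{\alpha,t}-1$, set $X_\alpha=V_{\alpha,\alpha+1}(x_\alpha,a_\alpha,b_\alpha)$, where $x_1=1$ and $x_2=a_1$ if $Q$ has the SW–NE diagonal, $x_2=b_1$ if NW–SE. Finally $S_t=X_2X_1$ if the chosen diagonal is SW–NE and $S_t=X_1X_2$ if it is NW–SE. $(M)_{1,1}$ is the top-left entry. *)

theory Defs
  imports
    "HOL-Analysis.Finite_Cartesian_Product"
    "HOL-Library.Poly_Mapping"
    "HOL-Library.Product_Lexorder"
    "HOL-Computational_Algebra.Fraction_Field"
begin

text \<open>
  Rational functions over the rationals in indeterminates indexed by pairs \<open>(\<alpha>, j)\<close>: the fraction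
  field of the polynomial ring whose elements are finitely supported functions from monomials
  (finitely supported exponent functions) to coefficients.  Indeterminates with \<open>\<alpha> \<notin> {1, 2}\<close> are
  present in the type but never used.  The lexicographic order on the index pairs is only needed
  for the library's proof that this polynomial ring is an integral domain.
\<close>

type_synonym ratfun = "(((nat \<times> int) \<Rightarrow>\<^sub>0 nat) \<Rightarrow>\<^sub>0 rat) fract"

definition bvar :: "nat \<Rightarrow> int \<Rightarrow> ratfun" where
  "bvar \<alpha> j = Fract (Poly_Mapping.single (Poly_Mapping.single (\<alpha>, j) 1) 1) 1"

definition admissible_boundary :: "(nat \<Rightarrow> int \<Rightarrow> int) \<Rightarrow> bool" where
  "admissible_boundary \<kappa> \<longleftrightarrow>
     (\<forall>\<alpha>\<in>{1, 2}. \<forall>j. even (int \<alpha> + j + \<kappa> \<alpha> j)) \<and>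
     (\<forall>j. \<bar>\<kappa> 2 j - \<kappa> 1 j\<bar> = 1) \<and>
     (\<forall>\<alpha>\<in>{1, 2}. \<forall>j. \<bar>\<kappa> \<alpha> (j + 1) - \<kappa> \<alpha> j\<bar> = 1) \<and>
     (\<exists>c Jm Jp. even c \<and> Jm \<le> Jp \<and>
        (\<forall>\<alpha>\<in>{1, 2}. \<forall>j. j < Jm \<or> j > Jp \<longrightarrow> \<kappa> \<alpha> j = c + (int \<alpha> + j) mod 2))"

text \<open>
  Only the values \<open>T \<alpha> j k\<close> with \<open>\<alpha> \<in> {1, 2}\<close> and \<open>\<alpha> + j + k\<close> even are constrained; the relation for
  \<open>\<alpha>\<close> centred at \<open>(j, k)\<close> involves such points exactly when \<open>\<alpha> + j + k\<close> is odd.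
\<close>

definition A2_T_system :: "(nat \<Rightarrow> int \<Rightarrow> int \<Rightarrow> 'a::comm_semiring_1) \<Rightarrow> bool" where
  "A2_T_system T \<longleftrightarrow>
     (\<forall>j k. odd (1 + j + k) \<longrightarrow>
        T 1 j (k + 1) * T 1 j (k - 1) = T 1 (j + 1) k * T 1 (j - 1) k + T 2 j k) \<and>
     (\<forall>j k. odd (2 + j + k) \<longrightarrow>
        T 2 j (k + 1) * T 2 j (k - 1) = T 2 (j + 1) k * T 2 (j - 1) k + T 1 j k)"

text \<open>
  The rows and columns of a \<open>3 \<times> 3\<close> matrix are indexed by \<open>1, 2, 3\<close> of the numeral type \<open>3\<close>, in
  which \<open>3 = 0\<close>; the index \<open>\<alpha>\<close> of the block is meant to be \<open>1\<close> or \<open>2\<close>.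
\<close>

definition H_mat :: "3 \<Rightarrow> 'a::field \<Rightarrow> 'a \<Rightarrow> 'a \<Rightarrow> 'a^3^3" where
  "H_mat \<alpha> a b u = (\<chi> r c.
     if r = \<alpha> + 1 \<and> c = \<alpha> then u / b
     else if r = \<alpha> + 1 \<and> c = \<alpha> + 1 then a / b
     else if r = c then 1 else 0)"

definition V_mat :: "3 \<Rightarrow> 'a::field \<Rightarrow> 'a \<Rightarrow> 'a \<Rightarrow> 'a^3^3" where
  "V_mat \<alpha> x a b = (\<chi> r c.
     if r = \<alpha> \<and> c = \<alpha> then a / b
     else if r = \<alpha> \<and> c = \<alpha> + 1 then x / b
     else if r = c then 1 else 0)"

datatype diagonal = SW_NE | NW_SE

fun admissible_diagonal :: "(nat \<Rightarrow> int \<Rightarrow> int) \<Rightarrow> int \<Rightarrow> diagonal \<Rightarrow> bool" where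
  "admissible_diagonal \<kappa> t SW_NE \<longleftrightarrow> \<kappa> 1 t = \<kappa> 2 (t + 1)"
| "admissible_diagonal \<kappa> t NW_SE \<longleftrightarrow> \<kappa> 1 (t + 1) = \<kappa> 2 t"

text \<open>
  On an admissible boundary the \<open>else\<close> branches below are exactly the cases
  \<open>\<kappa> \<alpha> (t + 1) = \<kappa> \<alpha> t - 1\<close>.
\<close>

definition slice_matrix ::
  "(nat \<Rightarrow> int \<Rightarrow> int) \<Rightarrow> (nat \<Rightarrow> int \<Rightarrow> int \<Rightarrow> 'a::field) \<Rightarrow> (int \<Rightarrow> diagonal) \<Rightarrow> int \<Rightarrow> 'a^3^3" where
  "slice_matrix \<kappa> T \<delta> t =
     (let a = (\<lambda>\<alpha>. T \<alpha> t (\<kappa> \<alpha> t));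
          b = (\<lambda>\<alpha>. T \<alpha> (t + 1) (\<kappa> \<alpha> (t + 1)));
          u1 = (case \<delta> t of SW_NE \<Rightarrow> b 2 | NW_SE \<Rightarrow> a 2);
          x2 = (case \<delta> t of SW_NE \<Rightarrow> a 1 | NW_SE \<Rightarrow> b 1);
          X1 = (if \<kappa> 1 (t + 1) = \<kappa> 1 t + 1 then H_mat 1 (a 1) (b 1) u1 else V_mat 1 1 (a 1) (b 1));
          X2 = (if \<kappa> 2 (t + 1) = \<kappa> 2 t + 1 then H_mat 2 (a 2) (b 2) 1 else V_mat 2 x2 (a 2) (b 2))
      in case \<delta> t of SW_NE \<Rightarrow> X2 ** X1 | NW_SE \<Rightarrow> X1 ** X2)"

definition slice_product ::
  "(nat \<Rightarrow> int \<Rightarrow> int) \<Rightarrow> (nat \<Rightarrow> int \<Rightarrow> int \<Rightarrow> 'a::field) \<Rightarrow> (int \<Rightarrow> diagonal) \<Rightarrow> int \<Rightarrow> int \<Rightarrow> 'a^3^3" where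
  "slice_product \<kappa> T \<delta> m n = foldr (**) (map (slice_matrix \<kappa> T \<delta>) [m..n - 1]) (mat 1)"

end

theory Submission
  imports Defs "HOL-Analysis.Cartesian_Space"
begin

text \<open>
  A product of slice matrices does not change when the boundary is raised by 2 at a local minimum
  strictly inside its range: the exchange relation between the \<open>V\<close> and \<open>H\<close> matrices is
  exactly the T-system relation at that vertex. By such moves the boundary between \<open>j\<^sub>0\<close> and
  \<open>j\<^sub>1\<close>, with its end columns fixed, can be raised until its first row is the tent
  \<open>k - \<bar>i - j\<bar>\<close> with apex \<open>(1, j, k)\<close>. On the ascending side the slice matrices have first row
  \<open>(1, 0, 0)\<close>; on the descending side their first columns are \<open>(a/b, 0, 0)\<close> and the quotients
  telescope to \<open>T\<^bsub>1,j,k\<^esub> / T\<^bsub>1,j1,\<kappa>(1,j1)\<^esub>\<close>. The values of \<open>T\<close> met on the way are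
  subtraction-free in the boundary values, hence nonzero.
\<close>

section \<open>Positive rational functions\<close>

text \<open>The T-system determines a raised value only after division by an old one, so
  nonvanishing must travel along with the mutations. Closure under the subtraction-free operations,
  with 0 excluded, is what carries it.\<close>

locale positive_cone =
  fixes P :: "'a::field set"
  assumes add_closed: "x \<in> P \<Longrightarrow> y \<in> P \<Longrightarrow> x + y \<in> P"
    and mult_closed: "x \<in> P \<Longrightarrow> y \<in> P \<Longrightarrow> x * y \<in> P"
    and divide_closed: "x \<in> P \<Longrightarrow> y \<in> P \<Longrightarrow> x / y \<in> P"
    and zero_notin: "0 \<notin> P"

definition nonneg_coeffs :: "('a \<Rightarrow>\<^sub>0 'b::linordered_idom) \<Rightarrow> bool" where
  "nonneg_coeffs p \<longleftrightarrow> (\<forall>m. Poly_Mapping.lookup p m \<ge> 0)"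

lemma nonneg_coeffs_add: "nonneg_coeffs p \<Longrightarrow> nonneg_coeffs q \<Longrightarrow> nonneg_coeffs (p + q)"
  by (simp add: nonneg_coeffs_def lookup_add)

lemma Sum_any_nonneg:
  fixes f :: "'a \<Rightarrow> 'b::ordered_comm_monoid_add"
  shows "(\<And>x. 0 \<le> f x) \<Longrightarrow> 0 \<le> Sum_any f"
  by (simp add: Sum_any.expand_set sum_nonneg)

lemma nonneg_coeffs_mult:
  fixes p q :: "'a::monoid_add \<Rightarrow>\<^sub>0 'b::linordered_idom"
  shows "nonneg_coeffs p \<Longrightarrow> nonneg_coeffs q \<Longrightarrow> nonneg_coeffs (p * q)"
  unfolding nonneg_coeffs_def lookup_mult
  by (auto intro!: Sum_any_nonneg mult_nonneg_nonneg simp: when_def)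

text \<open>No cancellation can occur: a nonzero coefficient of \<open>p\<close> is positive and
  stays positive in the sum. This keeps the numerator of a sum of positive fractions
  nonzero.\<close>

lemma nonneg_coeffs_add_nonzero:
  assumes "nonneg_coeffs p" "nonneg_coeffs q" "p \<noteq> 0"
  shows "p + q \<noteq> 0"
proof -
  obtain m where "Poly_Mapping.lookup p m \<noteq> 0"
    using \<open>p \<noteq> 0\<close> by (auto simp: poly_mapping_eq_iff fun_eq_iff)
  then have "Poly_Mapping.lookup (p + q) m > 0"
    using assms(1,2) by (metis add_pos_nonneg lookup_add nonneg_coeffs_def order_less_le)
  then show ?thesis by auto
qed

definition positive_ratfuns :: "ratfun set" where
  "positive_ratfuns =
     {Fract p q | p q. p \<noteq> 0 \<and> q \<noteq> 0 \<and> nonneg_coeffs p \<and> nonneg_coeffs q}"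

lemma positive_ratfunsI:
  "p \<noteq> 0 \<Longrightarrow> q \<noteq> 0 \<Longrightarrow> nonneg_coeffs p \<Longrightarrow> nonneg_coeffs q \<Longrightarrow> Fract p q \<in> positive_ratfuns"
  by (auto simp: positive_ratfuns_def)

interpretation positive_ratfuns: positive_cone positive_ratfuns
proof
  fix x y :: ratfun
  assume "x \<in> positive_ratfuns" "y \<in> positive_ratfuns"
  then obtain p q r s where x: "x = Fract p q" and y: "y = Fract r s"
    and nz: "p \<noteq> 0" "q \<noteq> 0" "r \<noteq> 0" "s \<noteq> 0"
    and nn: "nonneg_coeffs p" "nonneg_coeffs q" "nonneg_coeffs r" "nonneg_coeffs s"
    by (auto simp: positive_ratfuns_def)
  show "x + y \<in> positive_ratfuns"
    unfolding x y using nz nn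
    by (auto simp: nonneg_coeffs_add nonneg_coeffs_mult nonneg_coeffs_add_nonzero
        intro!: positive_ratfunsI)
  show "x * y \<in> positive_ratfuns" "x / y \<in> positive_ratfuns"
    unfolding x y using nz nn by (auto simp: nonneg_coeffs_mult intro!: positive_ratfunsI)
next
  show "0 \<notin> positive_ratfuns"
    by (auto simp: positive_ratfuns_def Zero_fract_def eq_fract)
qed

lemma bvar_positive: "bvar \<alpha> j \<in> positive_ratfuns"
  unfolding bvar_def
proof (rule positive_ratfunsI)
  show "nonneg_coeffs (1 :: ((nat \<times> int) \<Rightarrow>\<^sub>0 nat) \<Rightarrow>\<^sub>0 rat)"
    by (simp add: nonneg_coeffs_def lookup_one when_def)
  show "Poly_Mapping.single (Poly_Mapping.single (\<alpha>, j) 1) (1 :: rat) \<noteq> 0"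
    by (metis lookup_single_eq lookup_zero zero_neq_one)
qed (simp_all add: nonneg_coeffs_def lookup_single when_def)

section \<open>Slice matrices\<close>

lemma mat3_eq_iff:
  fixes A B :: "'a^3^3"
  shows "A = B \<longleftrightarrow> (\<forall>r\<in>{1, 2, 3}. \<forall>c\<in>{1, 2, 3}. A $ r $ c = B $ r $ c)"
  by (simp add: vec_eq_iff forall_3)

lemma mat_mult3:
  fixes A B :: "'a::semiring_1^3^3"
  shows "(A ** B) $ r $ c = A $ r $ 1 * B $ 1 $ c + A $ r $ 2 * B $ 2 $ c + A $ r $ 3 * B $ 3 $ c"
  by (simp add: matrix_matrix_mult_def sum_3)

text \<open>Two neighbouring slices form a product of four elementary matrices; the exchange
  relation concerns the middle two.\<close>

lemma mat_mult_cong_middle: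
  fixes A B C D X Y :: "'a::semiring_1^'n^'n"
  assumes "A ** B = C ** D"
  shows "(X ** A) ** (B ** Y) = (X ** C) ** (D ** Y)"
proof -
  have "(X ** A) ** (B ** Y) = X ** (A ** B) ** Y" by (simp only: matrix_mul_assoc)
  also have "\<dots> = (X ** C) ** (D ** Y)" by (simp only: assms matrix_mul_assoc)
  finally show ?thesis .
qed

text \<open>Multiplied out, the two products have the same off-diagonal entries \<open>x / c\<close>
  and \<open>u / c\<close> in the block. The two diagonal entries agree by \<open>e1\<close> and
  \<open>e2\<close>, and each of these is the relation \<open>b' * b = a * c + u * x\<close> with
  denominators cleared.\<close>

lemma H_mat_V_mat_exchange:
  fixes a b b' c u x :: "'a::field"
  assumes "\<alpha> \<in> {1, 2}" "b \<noteq> 0" "b' \<noteq> 0" "c \<noteq> 0" and "b' * b = a * c + u * x"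
  shows "V_mat \<alpha> x a b ** H_mat \<alpha> b c u = H_mat \<alpha> a b' u ** V_mat \<alpha> x b' c"
proof -
  have e1: "a / b + x * u / (b * c) = b' / c" and e2: "u * x / (b' * c) + a / b' = b / c"
    using assms(2-4) assms(5)[symmetric] by (simp_all add: divide_simps, simp_all add: algebra_simps)
  show ?thesis
    using assms(1-4) e1 e2
    by (auto simp: mat3_eq_iff mat_mult3 H_mat_def V_mat_def)
qed

text \<open>Both factors differ from the identity only in row 2, so interchanging them rescales the
  off-diagonal entries. The passage from \<open>b2\<close> to \<open>a2\<close> in
  \<open>H_mat\<close> and from \<open>a1\<close> to \<open>b1\<close> in \<open>V_mat\<close>
  compensates exactly; it is the dependence of \<open>u1\<close> and \<open>x2\<close> on the
  diagonal.\<close>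

lemma H_mat_V_mat_commute:
  fixes a1 a2 b1 b2 :: "'a::field"
  assumes "b1 \<noteq> 0" "b2 \<noteq> 0"
  shows "V_mat 2 a1 a2 b2 ** H_mat 1 a1 b1 b2 = H_mat 1 a1 b1 a2 ** V_mat 2 b1 a2 b2"
  using assms by (auto simp: mat3_eq_iff mat_mult3 H_mat_def V_mat_def mult.commute)

text \<open>The deviations from the identity sit in row 3, columns 2 and 3, and in row 1, columns 1
  and 2; their products vanish in both orders.\<close>

lemma V_mat_H_mat_commute:
  "H_mat 2 a2 b2 1 ** V_mat 1 1 a1 b1 = V_mat 1 1 a1 b1 ** H_mat 2 a2 b2 1"
  by (auto simp: mat3_eq_iff mat_mult3 H_mat_def V_mat_def)

text \<open>The local conditions of an admissible boundary, which are those checked after each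
  mutation. The condition at infinity enters through
  \<open>admissible_boundary_bounded\<close>.\<close>

definition step_boundary :: "(nat \<Rightarrow> int \<Rightarrow> int) \<Rightarrow> bool" where
  "step_boundary \<kappa> \<longleftrightarrow>
     (\<forall>\<alpha>\<in>{1, 2}. \<forall>j. even (int \<alpha> + j + \<kappa> \<alpha> j)) \<and>
     (\<forall>j. \<bar>\<kappa> 2 j - \<kappa> 1 j\<bar> = 1) \<and>
     (\<forall>\<alpha>\<in>{1, 2}. \<forall>j. \<bar>\<kappa> \<alpha> (j + 1) - \<kappa> \<alpha> j\<bar> = 1)"

lemma step_boundaryD:
  assumes "step_boundary \<kappa>"
  shows "even (1 + j + \<kappa> 1 j)" "even (j + \<kappa> 2 j)" "\<bar>\<kappa> 2 j - \<kappa> 1 j\<bar> = 1"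
    "\<bar>\<kappa> 1 (j + 1) - \<kappa> 1 j\<bar> = 1" "\<bar>\<kappa> 2 (j + 1) - \<kappa> 2 j\<bar> = 1"
    "\<bar>\<kappa> 1 j - \<kappa> 1 (j - 1)\<bar> = 1" "\<bar>\<kappa> 2 j - \<kappa> 2 (j - 1)\<bar> = 1"
proof -
  have "\<bar>\<kappa> \<alpha> (j - 1 + 1) - \<kappa> \<alpha> (j - 1)\<bar> = 1" if "\<alpha> \<in> {1, 2}" for \<alpha>
    using assms that unfolding step_boundary_def by blast
  from this[of 1] this[of 2]
  show "\<bar>\<kappa> 1 j - \<kappa> 1 (j - 1)\<bar> = 1" "\<bar>\<kappa> 2 j - \<kappa> 2 (j - 1)\<bar> = 1"
    by simp_all
  have "even (int \<alpha> + j + \<kappa> \<alpha> j)" if "\<alpha> \<in> {1, 2}" for \<alpha>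
    using assms that unfolding step_boundary_def by blast
  from this[of 1] this[of 2] show "even (1 + j + \<kappa> 1 j)" "even (j + \<kappa> 2 j)"
    by simp_all
qed (use assms in \<open>auto simp: step_boundary_def\<close>)

lemma step_boundary_lipschitz:
  assumes "step_boundary \<kappa>" "i \<le> i'"
  shows "\<bar>\<kappa> 1 i' - \<kappa> 1 i\<bar> \<le> i' - i"
  using \<open>i \<le> i'\<close>
proof (induction i' rule: int_ge_induct)
  case (step i')
  then show ?case using step_boundaryD(4)[OF assms(1), of i'] by linarith
qed simp

text \<open>If row 1 does not step to the height \<open>\<kappa> 2 t\<close>, it steps away from it,
  and then row 2 has to come back to \<open>\<kappa> 1 t\<close> to stay at distance 1. A mutation
  can destroy the admissibility of a diagonal, so choices for new boundaries are taken from
  here.\<close>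

lemma admissible_diagonal_exists:
  assumes "step_boundary \<kappa>"
  obtains \<delta> where "\<And>t. admissible_diagonal \<kappa> t (\<delta> t)"
proof -
  have "\<exists>d. admissible_diagonal \<kappa> t d" for t
  proof -
    have "\<kappa> 1 t = \<kappa> 2 (t + 1) \<or> \<kappa> 1 (t + 1) = \<kappa> 2 t"
      using step_boundaryD(3)[OF assms, of t] step_boundaryD(3)[OF assms, of "t + 1"]
        step_boundaryD(4,5)[OF assms, of t] by linarith
    then show ?thesis by (metis admissible_diagonal.simps)
  qed
  then show thesis using that by metis
qed

lemma slice_matrix_SW_NE:
  fixes T :: "nat \<Rightarrow> int \<Rightarrow> int \<Rightarrow> 'a::field"
  assumes "\<delta> t = SW_NE"
  shows "slice_matrix \<kappa> T \<delta> t =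
    (if \<kappa> 2 (t + 1) = \<kappa> 2 t + 1
     then H_mat 2 (T 2 t (\<kappa> 2 t)) (T 2 (t + 1) (\<kappa> 2 (t + 1))) 1
     else V_mat 2 (T 1 t (\<kappa> 1 t)) (T 2 t (\<kappa> 2 t)) (T 2 (t + 1) (\<kappa> 2 (t + 1)))) **
    (if \<kappa> 1 (t + 1) = \<kappa> 1 t + 1
     then H_mat 1 (T 1 t (\<kappa> 1 t)) (T 1 (t + 1) (\<kappa> 1 (t + 1))) (T 2 (t + 1) (\<kappa> 2 (t + 1)))
     else V_mat 1 1 (T 1 t (\<kappa> 1 t)) (T 1 (t + 1) (\<kappa> 1 (t + 1))))"
  using assms by (simp add: slice_matrix_def Let_def)

lemma slice_matrix_NW_SE:
  fixes T :: "nat \<Rightarrow> int \<Rightarrow> int \<Rightarrow> 'a::field"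
  assumes "\<delta> t = NW_SE"
  shows "slice_matrix \<kappa> T \<delta> t =
    (if \<kappa> 1 (t + 1) = \<kappa> 1 t + 1
     then H_mat 1 (T 1 t (\<kappa> 1 t)) (T 1 (t + 1) (\<kappa> 1 (t + 1))) (T 2 t (\<kappa> 2 t))
     else V_mat 1 1 (T 1 t (\<kappa> 1 t)) (T 1 (t + 1) (\<kappa> 1 (t + 1)))) **
    (if \<kappa> 2 (t + 1) = \<kappa> 2 t + 1
     then H_mat 2 (T 2 t (\<kappa> 2 t)) (T 2 (t + 1) (\<kappa> 2 (t + 1))) 1
     else V_mat 2 (T 1 (t + 1) (\<kappa> 1 (t + 1))) (T 2 t (\<kappa> 2 t)) (T 2 (t + 1) (\<kappa> 2 (t + 1))))"
  using assms by (simp add: slice_matrix_def Let_def)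

text \<open>When both diagonals are admissible, the two rows exchange their heights. One therefore
  goes up and the other down, so \<open>X1\<close> and \<open>X2\<close> are of different types and
  one of the two commutation lemmas applies.\<close>

lemma slice_matrix_both_diagonals:
  fixes T :: "nat \<Rightarrow> int \<Rightarrow> int \<Rightarrow> 'a::field"
  assumes "step_boundary \<kappa>" and nz: "\<And>\<alpha> i. \<alpha> \<in> {1, 2} \<Longrightarrow> T \<alpha> i (\<kappa> \<alpha> i) \<noteq> 0"
    and d: "admissible_diagonal \<kappa> t (\<delta> t)" "admissible_diagonal \<kappa> t (\<delta>' t)"
    and "\<delta> t = SW_NE" "\<delta>' t = NW_SE"
  shows "slice_matrix \<kappa> T \<delta> t = slice_matrix \<kappa> T \<delta>' t"
proof -
  have eq: "\<kappa> 1 t = \<kappa> 2 (t + 1)" "\<kappa> 1 (t + 1) = \<kappa> 2 t"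
    using d assms(5,6) by simp_all
  have "\<bar>\<kappa> 1 (t + 1) - \<kappa> 1 t\<bar> = 1" using step_boundaryD(4)[OF assms(1)] .
  then consider "\<kappa> 1 (t + 1) = \<kappa> 1 t + 1" | "\<kappa> 1 (t + 1) = \<kappa> 1 t - 1" by linarith
  then show ?thesis
  proof cases
    case 1
    then have "\<kappa> 2 (t + 1) \<noteq> \<kappa> 2 t + 1" using eq by linarith
    with 1 show ?thesis
      using H_mat_V_mat_commute[OF nz[of 1 "t + 1"] nz[of 2 "t + 1"]]
      by (simp add: slice_matrix_SW_NE[of \<delta> t, OF assms(5)] slice_matrix_NW_SE[of \<delta>' t, OF assms(6)])
  next
    case 2
    then have "\<kappa> 2 (t + 1) = \<kappa> 2 t + 1" using eq by linarith
    with 2 show ?thesis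
      using V_mat_H_mat_commute
      by (simp add: slice_matrix_SW_NE[of \<delta> t, OF assms(5)] slice_matrix_NW_SE[of \<delta>' t, OF assms(6)])
  qed
qed

lemma slice_matrix_diagonal_indep:
  fixes T :: "nat \<Rightarrow> int \<Rightarrow> int \<Rightarrow> 'a::field"
  assumes "step_boundary \<kappa>" and "\<And>\<alpha> i. \<alpha> \<in> {1, 2} \<Longrightarrow> T \<alpha> i (\<kappa> \<alpha> i) \<noteq> 0"
    and "admissible_diagonal \<kappa> t (\<delta> t)" "admissible_diagonal \<kappa> t (\<delta>' t)"
  shows "slice_matrix \<kappa> T \<delta> t = slice_matrix \<kappa> T \<delta>' t"
proof (cases "\<delta> t = \<delta>' t")
  case True
  then show ?thesis by (simp add: slice_matrix_def)
next
  case False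
  then consider "\<delta> t = SW_NE" "\<delta>' t = NW_SE" | "\<delta> t = NW_SE" "\<delta>' t = SW_NE"
    by (metis diagonal.exhaust)
  then show ?thesis
  proof cases
    case 1
    then show ?thesis
      using slice_matrix_both_diagonals[of \<kappa> T t \<delta> \<delta>'] assms by blast
  next
    case 2
    then show ?thesis
      using slice_matrix_both_diagonals[of \<kappa> T t \<delta>' \<delta>] assms by metis
  qed
qed

lemma slice_matrix_cong:
  assumes "\<And>\<alpha> i. \<alpha> \<in> {1, 2} \<Longrightarrow> i \<in> {t, t + 1} \<Longrightarrow> \<kappa> \<alpha> i = \<kappa>' \<alpha> i"
  shows "slice_matrix \<kappa> T \<delta> t = slice_matrix \<kappa>' T \<delta> t"
proof -
  have "\<kappa> 1 t = \<kappa>' 1 t" "\<kappa> 1 (t + 1) = \<kappa>' 1 (t + 1)"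
    "\<kappa> 2 t = \<kappa>' 2 t" "\<kappa> 2 (t + 1) = \<kappa>' 2 (t + 1)"
    using assms by auto
  then show ?thesis by (simp only: slice_matrix_def Let_def)
qed

lemma admissible_diagonal_cong:
  assumes "\<And>\<alpha> i. \<alpha> \<in> {1, 2} \<Longrightarrow> i \<in> {t, t + 1} \<Longrightarrow> \<kappa> \<alpha> i = \<kappa>' \<alpha> i"
  shows "admissible_diagonal \<kappa> t d \<longleftrightarrow> admissible_diagonal \<kappa>' t d"
  by (cases d) (simp_all add: assms)

section \<open>Products of consecutive slice matrices\<close>

lemma slice_product_rec:
  "m < n \<Longrightarrow> slice_product \<kappa> T \<delta> m n = slice_matrix \<kappa> T \<delta> m ** slice_product \<kappa> T \<delta> (m + 1) n"
  by (simp add: slice_product_def upto_rec1)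

lemma slice_product_empty: "slice_product \<kappa> T \<delta> m m = mat 1"
  by (simp add: slice_product_def)

lemma slice_product_cong:
  assumes "\<And>i. m \<le> i \<Longrightarrow> i < n \<Longrightarrow> slice_matrix \<kappa> T \<delta> i = slice_matrix \<kappa>' T \<delta>' i"
  shows "slice_product \<kappa> T \<delta> m n = slice_product \<kappa>' T \<delta>' m n"
proof -
  have "map (slice_matrix \<kappa> T \<delta>) [m..n - 1] = map (slice_matrix \<kappa>' T \<delta>') [m..n - 1]"
    using assms by simp
  then show ?thesis by (simp only: slice_product_def)
qed

text \<open>Raising the boundary in column \<open>t\<close> affects the slices \<open>t - 1\<close>
  and \<open>t\<close>. Only their product is preserved, not each of them.\<close>

lemma slice_product_cong_pair:
  assumes "m < t" "t < n"
    and pair: "slice_matrix \<kappa> T \<delta> (t - 1) ** slice_matrix \<kappa> T \<delta> t =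
      slice_matrix \<kappa>' T \<delta>' (t - 1) ** slice_matrix \<kappa>' T \<delta>' t"
    and rest: "\<And>i. i \<noteq> t - 1 \<Longrightarrow> i \<noteq> t \<Longrightarrow> slice_matrix \<kappa> T \<delta> i = slice_matrix \<kappa>' T \<delta>' i"
  shows "slice_product \<kappa> T \<delta> m n = slice_product \<kappa>' T \<delta>' m n"
proof -
  have "[m..n - 1] = [m..t - 2] @ [t - 1..n - 1]"
    using upto_split1[of m "t - 1" "n - 1"] assms(1,2) by simp
  also have "[t - 1..n - 1] = (t - 1) # t # [t + 1..n - 1]"
    using assms(1,2) by (simp add: upto_rec1)
  finally have split: "[m..n - 1] = [m..t - 2] @ (t - 1) # t # [t + 1..n - 1]" .
  have "map (slice_matrix \<kappa> T \<delta>) [m..t - 2] = map (slice_matrix \<kappa>' T \<delta>') [m..t - 2]"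
    "map (slice_matrix \<kappa> T \<delta>) [t + 1..n - 1] = map (slice_matrix \<kappa>' T \<delta>') [t + 1..n - 1]"
    using rest by auto
  then show ?thesis
    by (simp only: slice_product_def split map_append list.map foldr_append foldr_Cons o_apply
        matrix_mul_assoc pair)
qed

section \<open>Mutations of the boundary\<close>

lemma A2_T_systemD:
  assumes "A2_T_system T"
  shows "odd (1 + j + k) \<Longrightarrow>
      T 1 j (k + 1) * T 1 j (k - 1) = T 1 (j + 1) k * T 1 (j - 1) k + T 2 j k"
    and "odd (j + k) \<Longrightarrow>
      T 2 j (k + 1) * T 2 j (k - 1) = T 2 (j + 1) k * T 2 (j - 1) k + T 1 j k"
  using assms by (auto simp: A2_T_system_def)

definition raise :: "(nat \<Rightarrow> int \<Rightarrow> int) \<Rightarrow> nat \<Rightarrow> int \<Rightarrow> nat \<Rightarrow> int \<Rightarrow> int" where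
  "raise \<kappa> \<alpha> t = \<kappa>(\<alpha> := (\<kappa> \<alpha>)(t := \<kappa> \<alpha> t + 2))"

text \<open>The three neighbours required to lie one higher are exactly the points on the right-hand
  side of the T-system relation centred between the old and the raised vertex. For \<alpha> in {1,
  2}, \<open>3 - \<alpha>\<close> is the other row.\<close>

definition local_min :: "(nat \<Rightarrow> int \<Rightarrow> int) \<Rightarrow> nat \<Rightarrow> int \<Rightarrow> bool" where
  "local_min \<kappa> \<alpha> t \<longleftrightarrow> \<kappa> \<alpha> (t + 1) = \<kappa> \<alpha> t + 1 \<and> \<kappa> \<alpha> (t - 1) = \<kappa> \<alpha> t + 1 \<and>
     \<kappa> (3 - \<alpha>) t = \<kappa> \<alpha> t + 1"

lemma raise_apply: "raise \<kappa> \<alpha> t \<beta> i = (if \<beta> = \<alpha> \<and> i = t then \<kappa> \<alpha> t + 2 else \<kappa> \<beta> i)"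
  by (simp add: raise_def)

lemma step_boundary_raise:
  assumes "step_boundary \<kappa>" "\<alpha> \<in> {1, 2}" "local_min \<kappa> \<alpha> t"
  shows "step_boundary (raise \<kappa> \<alpha> t)"
proof -
  have lm: "\<kappa> \<alpha> (t + 1) = \<kappa> \<alpha> t + 1" "\<kappa> \<alpha> (t - 1) = \<kappa> \<alpha> t + 1" "\<kappa> (3 - \<alpha>) t = \<kappa> \<alpha> t + 1"
    using assms(3) by (simp_all add: local_min_def)
  have "\<bar>raise \<kappa> \<alpha> t \<beta> (j + 1) - raise \<kappa> \<alpha> t \<beta> j\<bar> = 1" if "\<beta> \<in> {1, 2}" for \<beta> j
  proof -
    have b: "\<bar>\<kappa> \<beta> (j + 1) - \<kappa> \<beta> j\<bar> = 1"
      using assms(1) that unfolding step_boundary_def by blast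
    consider "\<beta> = \<alpha>" "j = t" | "\<beta> = \<alpha>" "j = t - 1" | "\<beta> \<noteq> \<alpha> \<or> (j \<noteq> t \<and> j \<noteq> t - 1)"
      by blast
    then show ?thesis
      using b by cases (auto simp: raise_apply lm(1,2))
  qed
  moreover have "\<bar>raise \<kappa> \<alpha> t 2 j - raise \<kappa> \<alpha> t 1 j\<bar> = 1" for j
    using assms(2) lm(3) step_boundaryD(3)[OF assms(1), of j]
    by (elim insertE) (simp_all add: raise_apply)
  moreover have "even (int \<beta> + j + raise \<kappa> \<alpha> t \<beta> j)" if "\<beta> \<in> {1, 2}" for \<beta> j
  proof -
    have "even (int \<beta> + j + \<kappa> \<beta> j)"
      using assms(1) that unfolding step_boundary_def by blast
    then show ?thesis by (simp add: raise_apply)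
  qed
  ultimately show ?thesis by (simp add: step_boundary_def)
qed

section \<open>Invariance of the slice product under mutations with positive values\<close>

context positive_cone
begin

lemma nonzero: "x \<in> P \<Longrightarrow> x \<noteq> 0"
  using zero_notin by blast

lemma T_relation_at_local_min:
  assumes "step_boundary \<kappa>" "\<alpha> \<in> {1, 2}" "local_min \<kappa> \<alpha> t" "A2_T_system T"
  shows "T \<alpha> t (\<kappa> \<alpha> t + 2) * T \<alpha> t (\<kappa> \<alpha> t) =
    T \<alpha> (t - 1) (\<kappa> \<alpha> (t - 1)) * T \<alpha> (t + 1) (\<kappa> \<alpha> (t + 1)) + T (3 - \<alpha>) t (\<kappa> (3 - \<alpha>) t)"
proof -
  have p: "odd (1 + t + (\<kappa> 1 t + 1))" "odd (t + (\<kappa> 2 t + 1))"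
    using step_boundaryD(1,2)[OF assms(1), of t] by presburger+
  show ?thesis
    using assms(2,3) A2_T_systemD(1)[OF assms(4) p(1)] A2_T_systemD(2)[OF assms(4) p(2)]
    by (auto simp: local_min_def algebra_simps)
qed

text \<open>The T-system relation writes the raised value as a sum of products of old boundary
  values, divided by the old value at the same vertex.\<close>

lemma raise_positive:
  assumes "step_boundary \<kappa>" "\<alpha> \<in> {1, 2}" "local_min \<kappa> \<alpha> t" "A2_T_system T"
    and pos: "\<And>\<beta> i. \<beta> \<in> {1, 2} \<Longrightarrow> T \<beta> i (\<kappa> \<beta> i) \<in> P"
    and "\<beta> \<in> {1, 2}"
  shows "T \<beta> i (raise \<kappa> \<alpha> t \<beta> i) \<in> P"
proof (cases "\<beta> = \<alpha> \<and> i = t")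
  case True
  have "3 - \<alpha> \<in> {1, 2}" using assms(2) by auto
  then have "T \<alpha> t (\<kappa> \<alpha> t + 2) * T \<alpha> t (\<kappa> \<alpha> t) \<in> P"
    unfolding T_relation_at_local_min[OF assms(1-4)]
    using assms(2) by (intro add_closed mult_closed pos)
  then have "T \<alpha> t (\<kappa> \<alpha> t + 2) * T \<alpha> t (\<kappa> \<alpha> t) / T \<alpha> t (\<kappa> \<alpha> t) \<in> P"
    using divide_closed pos[OF assms(2)] by blast
  then show ?thesis
    using True nonzero[OF pos[OF assms(2), of t]] by (simp add: raise_apply)
next
  case False
  then show ?thesis using pos[OF assms(6)] by (auto simp: raise_apply)
qed

text \<open>The two squares adjacent to the raised vertex can be cut along the diagonals avoiding that
  vertex, and these stay admissible. The two elementary matrices that involve the raised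
  value are then adjacent in the product and satisfy the exchange relation.\<close>

lemma slice_matrix_pair_raise:
  assumes "step_boundary \<kappa>" "\<alpha> \<in> {1, 2}" "local_min \<kappa> \<alpha> t" "A2_T_system T"
    and pos: "\<And>\<beta> i. \<beta> \<in> {1, 2} \<Longrightarrow> T \<beta> i (\<kappa> \<beta> i) \<in> P"
    and d: "\<And>i. admissible_diagonal \<kappa> i (\<delta> i)"
    and d': "\<And>i. admissible_diagonal (raise \<kappa> \<alpha> t) i (\<delta>' i)"
  shows "slice_matrix \<kappa> T \<delta> (t - 1) ** slice_matrix \<kappa> T \<delta> t =
    slice_matrix (raise \<kappa> \<alpha> t) T \<delta>' (t - 1) ** slice_matrix (raise \<kappa> \<alpha> t) T \<delta>' t"
proof -
  let ?\<kappa> = "raise \<kappa> \<alpha> t"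
  \<comment> \<open>The Boolean equation encodes the diagonals that avoid the vertex (\<alpha>, t):
    for \<alpha> = 1 these are SW-NE in square \<open>t - 1\<close> and NW-SE in square
    \<open>t\<close>, for \<alpha> = 2 the reverse.\<close>
  define \<epsilon> where "\<epsilon> i = (if (i = t) = (\<alpha> = 1) then NW_SE else SW_NE)" for i
  have sb': "step_boundary ?\<kappa>" using step_boundary_raise assms(1-3) .
  have pos': "T \<beta> i (?\<kappa> \<beta> i) \<in> P" if "\<beta> \<in> {1, 2}" for \<beta> i
    using raise_positive[OF assms(1-4) pos that] .
  have ad: "admissible_diagonal \<kappa> (t - 1) (\<epsilon> (t - 1))" "admissible_diagonal \<kappa> t (\<epsilon> t)"
    "admissible_diagonal ?\<kappa> (t - 1) (\<epsilon> (t - 1))" "admissible_diagonal ?\<kappa> t (\<epsilon> t)"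
    using assms(2,3) by (auto simp: \<epsilon>_def local_min_def raise_apply)
  have eqs: "slice_matrix \<kappa> T \<delta> (t - 1) = slice_matrix \<kappa> T \<epsilon> (t - 1)"
    "slice_matrix \<kappa> T \<delta> t = slice_matrix \<kappa> T \<epsilon> t"
    "slice_matrix ?\<kappa> T \<delta>' (t - 1) = slice_matrix ?\<kappa> T \<epsilon> (t - 1)"
    "slice_matrix ?\<kappa> T \<delta>' t = slice_matrix ?\<kappa> T \<epsilon> t"
    using ad d d' pos pos' nonzero
    by (auto intro!: slice_matrix_diagonal_indep assms(1) sb')
  let ?a = "T \<alpha> (t - 1) (\<kappa> \<alpha> (t - 1))" and ?b = "T \<alpha> t (\<kappa> \<alpha> t)"
    and ?b' = "T \<alpha> t (\<kappa> \<alpha> t + 2)" and ?c = "T \<alpha> (t + 1) (\<kappa> \<alpha> (t + 1))"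
    and ?w = "T (3 - \<alpha>) t (\<kappa> (3 - \<alpha>) t)"
  have rel: "?b' * ?b = ?a * ?c + ?w"
    using T_relation_at_local_min[OF assms(1-4)] .
  have nz: "?b \<noteq> 0" "?b' \<noteq> 0" "?c \<noteq> 0"
    using nonzero[OF pos] nonzero[OF pos'[of \<alpha> t]] assms(2) by (auto simp: raise_apply)
  consider "\<alpha> = 1" | "\<alpha> = 2" using assms(2) by blast
  then show ?thesis
  proof cases
    case 1
    have lm: "\<kappa> 1 (t + 1) = \<kappa> 1 t + 1" "\<kappa> 1 (t - 1) = \<kappa> 1 t + 1"
      using assms(3) 1 by (simp_all add: local_min_def)
    have e: "\<epsilon> (t - 1) = SW_NE" "\<epsilon> t = NW_SE" using 1 by (simp_all add: \<epsilon>_def)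
    \<comment> \<open>The value \<open>?w\<close> of the other row enters as \<open>u\<close>, with
      \<open>x = 1\<close>. For \<alpha> = 2 the roles are reversed; in both cases
      \<open>u * x\<close> is \<open>?w\<close>.\<close>
    have ex: "V_mat 1 1 ?a ?b ** H_mat 1 ?b ?c ?w = H_mat 1 ?a ?b' ?w ** V_mat 1 1 ?b' ?c"
      using H_mat_V_mat_exchange[OF _ nz, of 1 ?a ?w 1] rel by simp
    show ?thesis
      unfolding eqs slice_matrix_SW_NE[of \<epsilon> "t - 1", OF e(1)] slice_matrix_NW_SE[of \<epsilon> t, OF e(2)]
      using mat_mult_cong_middle[OF ex] lm 1
      by (simp add: raise_apply cong: if_cong split del: if_split)
  next
    case 2
    have lm: "\<kappa> 2 (t + 1) = \<kappa> 2 t + 1" "\<kappa> 2 (t - 1) = \<kappa> 2 t + 1"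
      using assms(3) 2 by (simp_all add: local_min_def)
    have e: "\<epsilon> (t - 1) = NW_SE" "\<epsilon> t = SW_NE" using 2 by (simp_all add: \<epsilon>_def)
    have ex: "V_mat 2 ?w ?a ?b ** H_mat 2 ?b ?c 1 = H_mat 2 ?a ?b' 1 ** V_mat 2 ?w ?b' ?c"
      using H_mat_V_mat_exchange[OF _ nz, of 2 ?a 1 ?w] rel by simp
    show ?thesis
      unfolding eqs slice_matrix_NW_SE[of \<epsilon> "t - 1", OF e(1)] slice_matrix_SW_NE[of \<epsilon> t, OF e(2)]
      using mat_mult_cong_middle[OF ex] lm 2
      by (simp add: raise_apply cong: if_cong split del: if_split)
  qed
qed

lemma slice_product_raise:
  assumes "step_boundary \<kappa>" "\<alpha> \<in> {1, 2}" "local_min \<kappa> \<alpha> t" "A2_T_system T"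
    and pos: "\<And>\<beta> i. \<beta> \<in> {1, 2} \<Longrightarrow> T \<beta> i (\<kappa> \<beta> i) \<in> P"
    and d: "\<And>i. admissible_diagonal \<kappa> i (\<delta> i)"
    and d': "\<And>i. admissible_diagonal (raise \<kappa> \<alpha> t) i (\<delta>' i)"
    and "m < t" "t < n"
  shows "slice_product \<kappa> T \<delta> m n = slice_product (raise \<kappa> \<alpha> t) T \<delta>' m n"
proof (rule slice_product_cong_pair[OF assms(8,9)])
  show "slice_matrix \<kappa> T \<delta> (t - 1) ** slice_matrix \<kappa> T \<delta> t =
    slice_matrix (raise \<kappa> \<alpha> t) T \<delta>' (t - 1) ** slice_matrix (raise \<kappa> \<alpha> t) T \<delta>' t"
    using slice_matrix_pair_raise[OF assms(1-7)] .
next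
  fix i
  assume "i \<noteq> t - 1" "i \<noteq> t"
  then have eq: "\<kappa> \<beta> i' = raise \<kappa> \<alpha> t \<beta> i'" if "i' \<in> {i, i + 1}" for \<beta> i'
    using that by (auto simp: raise_apply)
  \<comment> \<open>The boundary is unchanged around this square, but the two chosen diagonals may
    still differ.\<close>
  have "slice_matrix \<kappa> T \<delta> i = slice_matrix \<kappa> T \<delta>' i"
    using d d'[of i] admissible_diagonal_cong[of i \<kappa> "raise \<kappa> \<alpha> t" "\<delta>' i"] eq pos nonzero
    by (auto intro!: slice_matrix_diagonal_indep assms(1))
  also have "\<dots> = slice_matrix (raise \<kappa> \<alpha> t) T \<delta>' i"
    using slice_matrix_cong eq by blast
  finally show "slice_matrix \<kappa> T \<delta> i = slice_matrix (raise \<kappa> \<alpha> t) T \<delta>' i" .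
qed

text \<open>Induction on the total height still missing below \<kappa>'. As long as some is missing,
  a lowest deficient vertex is a local minimum and can be raised. The end columns \<open>m\<close>
  and \<open>n\<close> stay fixed because the argument needs both slices next to a raised vertex
  inside the product. Positivity along \<kappa>' is obtained on the way.\<close>

lemma slice_product_invariant:
  assumes "step_boundary \<kappa>" "step_boundary \<kappa>'" "A2_T_system T"
    and le: "\<And>\<alpha> i. \<alpha> \<in> {1, 2} \<Longrightarrow> \<kappa> \<alpha> i \<le> \<kappa>' \<alpha> i"
    and outside: "\<And>\<alpha> i. \<alpha> \<in> {1, 2} \<Longrightarrow> i \<notin> {m<..<n} \<Longrightarrow> \<kappa> \<alpha> i = \<kappa>' \<alpha> i"
    and pos: "\<And>\<alpha> i. \<alpha> \<in> {1, 2} \<Longrightarrow> T \<alpha> i (\<kappa> \<alpha> i) \<in> P"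
    and d: "\<And>i. admissible_diagonal \<kappa> i (\<delta> i)"
    and d': "\<And>i. admissible_diagonal \<kappa>' i (\<delta>' i)"
  shows "slice_product \<kappa> T \<delta> m n = slice_product \<kappa>' T \<delta>' m n \<and>
    (\<forall>\<alpha>\<in>{1, 2}. \<forall>i. T \<alpha> i (\<kappa>' \<alpha> i) \<in> P)"
  using assms(1) le outside pos d
proof (induction "\<Sum>(\<alpha>, i)\<in>{1, 2} \<times> {m<..<n}. nat (\<kappa>' \<alpha> i - \<kappa> \<alpha> i)"
    arbitrary: \<kappa> \<delta> rule: less_induct)
  case less
  define D where "D = {(\<alpha>, i) \<in> {1, 2} \<times> {m<..<n}. \<kappa> \<alpha> i < \<kappa>' \<alpha> i}"
  have "finite D" by (rule finite_subset[of _ "{1, 2} \<times> {m<..<n}"]) (auto simp: D_def)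
  show ?case
  proof (cases "D = {}")
    case True
    then have eq: "\<kappa> \<alpha> i = \<kappa>' \<alpha> i" if "\<alpha> \<in> {1, 2}" for \<alpha> i
      using less.prems(2)[OF that, of i] less.prems(3)[OF that, of i] that
      by (cases "i \<in> {m<..<n}") (fastforce simp: D_def)+
    have "slice_matrix \<kappa> T \<delta> i = slice_matrix \<kappa>' T \<delta>' i" for i
    proof -
      have "admissible_diagonal \<kappa> i (\<delta>' i)"
        using d'[of i] admissible_diagonal_cong[of i \<kappa> \<kappa>' "\<delta>' i"] eq by blast
      then have "slice_matrix \<kappa> T \<delta> i = slice_matrix \<kappa> T \<delta>' i"
        using less.prems(1,4,5) nonzero by (intro slice_matrix_diagonal_indep) auto
      also have "\<dots> = slice_matrix \<kappa>' T \<delta>' i"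
        using slice_matrix_cong eq by blast
      finally show ?thesis .
    qed
    then show ?thesis
      using slice_product_cong less.prems(4) eq by metis
  next
    case False
    \<comment> \<open>At a lowest vertex that has not yet reached \<open>\<kappa>'\<close>, a lower neighbour would already be on
      \<open>\<kappa>'\<close>, and \<open>\<kappa>'\<close> would make a jump of at least 3 there.\<close>
    obtain \<alpha> t where D: "(\<alpha>, t) \<in> D"
      and min: "\<And>\<beta> i. (\<beta>, i) \<in> D \<Longrightarrow> \<kappa> \<alpha> t \<le> \<kappa> \<beta> i"
      using ex_min_if_finite[of "(\<lambda>(\<beta>, i). \<kappa> \<beta> i) ` D"] \<open>finite D\<close> False
      by (force simp: not_less)
    have \<alpha>: "\<alpha> \<in> {1, 2}" "3 - \<alpha> \<in> {1, 2}" and t: "m < t" "t < n" and lt: "\<kappa> \<alpha> t < \<kappa>' \<alpha> t"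
      using D by (auto simp: D_def)
    have low: "\<kappa> \<beta> i = \<kappa>' \<beta> i" if "\<beta> \<in> {1, 2}" "\<kappa> \<beta> i < \<kappa> \<alpha> t" for \<beta> i
      using min[of \<beta> i] less.prems(2)[OF that(1), of i] less.prems(3)[OF that(1), of i] that
      by (cases "i \<in> {m<..<n}") (fastforce simp: D_def)+
    \<comment> \<open>By parity a deficient vertex lies at least 2 too low, so raising it by 2 does
      not overshoot \<kappa>'.\<close>
    have "even (\<kappa>' \<alpha> t - \<kappa> \<alpha> t)"
      using \<alpha> step_boundaryD(1,2)[OF less.prems(1), of t] step_boundaryD(1,2)[OF assms(2), of t]
      by auto
    then have gap: "\<kappa> \<alpha> t + 2 \<le> \<kappa>' \<alpha> t" using lt by presburger
    have up: "\<kappa> \<beta> i = \<kappa> \<alpha> t + 1"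
      if "\<beta> \<in> {1, 2}" "\<bar>\<kappa> \<beta> i - \<kappa> \<alpha> t\<bar> = 1" "\<bar>\<kappa>' \<beta> i - \<kappa>' \<alpha> t\<bar> = 1" for \<beta> i
      using low[of \<beta> i] that gap by linarith
    have nb: "\<bar>\<mu> \<alpha> (t + 1) - \<mu> \<alpha> t\<bar> = 1" "\<bar>\<mu> \<alpha> (t - 1) - \<mu> \<alpha> t\<bar> = 1"
      "\<bar>\<mu> (3 - \<alpha>) t - \<mu> \<alpha> t\<bar> = 1" if "step_boundary \<mu>" for \<mu>
      using \<alpha>(1) step_boundaryD(3-7)[OF that, of t]
      by (elim insertE; simp add: abs_minus_commute)+
    have lm: "local_min \<kappa> \<alpha> t"
      unfolding local_min_def
      using up[OF \<alpha>(1) nb(1)[OF less.prems(1)] nb(1)[OF assms(2)]]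
        up[OF \<alpha>(1) nb(2)[OF less.prems(1)] nb(2)[OF assms(2)]]
        up[OF \<alpha>(2) nb(3)[OF less.prems(1)] nb(3)[OF assms(2)]] by blast
    let ?\<kappa> = "raise \<kappa> \<alpha> t"
    have sb: "step_boundary ?\<kappa>" using step_boundary_raise[OF less.prems(1) \<alpha>(1) lm] .
    obtain \<epsilon> where \<epsilon>: "\<And>i. admissible_diagonal ?\<kappa> i (\<epsilon> i)"
      using admissible_diagonal_exists[OF sb] by blast
    have "(\<Sum>(\<beta>, i)\<in>{1, 2} \<times> {m<..<n}. nat (\<kappa>' \<beta> i - ?\<kappa> \<beta> i))
        < (\<Sum>(\<beta>, i)\<in>{1, 2} \<times> {m<..<n}. nat (\<kappa>' \<beta> i - \<kappa> \<beta> i))"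
    proof (rule sum_strict_mono_ex1)
      show "\<exists>x\<in>{1, 2} \<times> {m<..<n}. (case x of (\<beta>, i) \<Rightarrow> nat (\<kappa>' \<beta> i - ?\<kappa> \<beta> i))
          < (case x of (\<beta>, i) \<Rightarrow> nat (\<kappa>' \<beta> i - \<kappa> \<beta> i))"
        using \<alpha> t lt by (intro bexI[of _ "(\<alpha>, t)"]) (auto simp: raise_apply)
    qed (auto simp: raise_apply)
    moreover have "?\<kappa> \<beta> i \<le> \<kappa>' \<beta> i" if "\<beta> \<in> {1, 2}" for \<beta> i
      using less.prems(2)[OF that] gap by (auto simp: raise_apply)
    moreover have "?\<kappa> \<beta> i = \<kappa>' \<beta> i" if "\<beta> \<in> {1, 2}" "i \<notin> {m<..<n}" for \<beta> i
      using less.prems(3)[OF that] that t by (auto simp: raise_apply)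
    moreover have "T \<beta> i (?\<kappa> \<beta> i) \<in> P" if "\<beta> \<in> {1, 2}" for \<beta> i
      using raise_positive[OF less.prems(1) \<alpha>(1) lm assms(3) less.prems(4) that] .
    ultimately have "slice_product ?\<kappa> T \<epsilon> m n = slice_product \<kappa>' T \<delta>' m n \<and>
        (\<forall>\<alpha>\<in>{1, 2}. \<forall>i. T \<alpha> i (\<kappa>' \<alpha> i) \<in> P)"
      using less.hyps[OF _ sb _ _ _ \<epsilon>] by blast
    moreover have "slice_product \<kappa> T \<delta> m n = slice_product ?\<kappa> T \<epsilon> m n"
      using slice_product_raise[OF less.prems(1) \<alpha>(1) lm assms(3) less.prems(4,5) \<epsilon> t] .
    ultimately show ?thesis by simp
  qed
qed

end

section \<open>The tent-shaped boundary\<close>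

text \<open>Here \<open>X1\<close> is an \<open>H_mat\<close>. It and \<open>X2\<close> both have
  first row (1, 0, 0), and so does their product in either order.\<close>

lemma slice_matrix_up_row:
  fixes T :: "nat \<Rightarrow> int \<Rightarrow> int \<Rightarrow> 'a::field"
  assumes "\<kappa> 1 (t + 1) = \<kappa> 1 t + 1"
  shows "slice_matrix \<kappa> T \<delta> t $ 1 $ c = (if c = 1 then 1 else 0)"
  using assms
  by (cases "\<delta> t")
    (auto simp: slice_matrix_SW_NE slice_matrix_NW_SE mat_mult3 H_mat_def V_mat_def)

text \<open>The first unit vector is fixed by \<open>X2\<close> and is an eigenvector of
  \<open>X1\<close>, now a \<open>V_mat\<close>, with eigenvalue \<open>a / b\<close>. The order of
  the factors does not affect this.\<close>

lemma slice_matrix_down_column: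
  fixes T :: "nat \<Rightarrow> int \<Rightarrow> int \<Rightarrow> 'a::field"
  assumes "\<kappa> 1 (t + 1) = \<kappa> 1 t - 1"
  shows "slice_matrix \<kappa> T \<delta> t $ r $ 1 =
    (if r = 1 then T 1 t (\<kappa> 1 t) / T 1 (t + 1) (\<kappa> 1 (t + 1)) else 0)"
  using assms
  by (cases "\<delta> t")
    (auto simp: slice_matrix_SW_NE slice_matrix_NW_SE mat_mult3 H_mat_def V_mat_def)

lemma slice_product_up_row:
  fixes T :: "nat \<Rightarrow> int \<Rightarrow> int \<Rightarrow> 'a::field"
  assumes "m \<le> t" "t \<le> n" "\<And>i. m \<le> i \<Longrightarrow> i < t \<Longrightarrow> \<kappa> 1 (i + 1) = \<kappa> 1 i + 1"
  shows "slice_product \<kappa> T \<delta> m n $ 1 $ 1 = slice_product \<kappa> T \<delta> t n $ 1 $ 1"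
  using assms(1,3)
proof (induction m rule: int_le_induct)
  case (step i)
  have "\<kappa> 1 (i - 1 + 1) = \<kappa> 1 (i - 1) + 1" using step.hyps step.prems[of "i - 1"] by simp
  then have "slice_matrix \<kappa> T \<delta> (i - 1) $ 1 $ c = (if c = 1 then 1 else 0)" for c
    by (rule slice_matrix_up_row)
  with step show ?case
    using \<open>t \<le> n\<close> slice_product_rec[of "i - 1" n \<kappa> T \<delta>] by (simp add: mat_mult3)
qed simp

lemma slice_product_down_column:
  fixes T :: "nat \<Rightarrow> int \<Rightarrow> int \<Rightarrow> 'a::field"
  assumes "m \<le> n" "\<And>i. m \<le> i \<Longrightarrow> i < n \<Longrightarrow> \<kappa> 1 (i + 1) = \<kappa> 1 i - 1"
    and "\<And>i. T 1 i (\<kappa> 1 i) \<noteq> 0"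
  shows "slice_product \<kappa> T \<delta> m n $ r $ 1 = (if r = 1 then T 1 m (\<kappa> 1 m) / T 1 n (\<kappa> 1 n) else 0)"
  using assms(1,2)
proof (induction m arbitrary: r rule: int_le_induct)
  case base
  \<comment> \<open>The empty quotient \<open>x / x\<close> is 1 only for nonzero \<open>x\<close>,
    since division by 0 gives 0.\<close>
  then show ?case using assms(3) by (simp add: slice_product_empty mat_def)
next
  case (step i)
  have "\<kappa> 1 (i - 1 + 1) = \<kappa> 1 (i - 1) - 1" using step.hyps step.prems[of "i - 1"] by simp
  then have "slice_matrix \<kappa> T \<delta> (i - 1) $ r $ 1 =
      (if r = 1 then T 1 (i - 1) (\<kappa> 1 (i - 1)) / T 1 i (\<kappa> 1 i) else 0)"
    using slice_matrix_down_column[of \<kappa> "i - 1" T \<delta> r] by simp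
  with step show ?case
    using assms(3) slice_product_rec[of "i - 1" n \<kappa> T \<delta>] by (simp add: mat_mult3)
qed

text \<open>This guarantees that the \<open>Max\<close> and \<open>Min\<close> defining j0 and j1
  are attained. A function close to the identity crosses every level; where it does so for the last
  time, steps of at most 2 and the fixed parity force it to hit the level.\<close>

lemma level_set_finite_nonempty:
  fixes f :: "int \<Rightarrow> int"
  assumes step: "\<And>i. f (i + 1) \<le> f i + 2" and bound: "\<And>i. \<bar>f i - i\<bar> \<le> B"
    and parity: "\<And>i. even (f i - d)"
  shows "finite {i. f i = d}" "{i. f i = d} \<noteq> {}"
proof -
  show "finite {i. f i = d}"
  proof (rule finite_subset)
    show "{i. f i = d} \<subseteq> {d - B..d + B}"
    proof
      fix i assume "i \<in> {i. f i = d}"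
      then show "i \<in> {d - B..d + B}" using bound[of i] by auto
    qed
  qed simp
  \<comment> \<open>The lower cutoff makes the set finite while keeping \<open>d - B\<close> in it.
    It holds for \<open>i + 1\<close> whenever it holds for \<open>i\<close>, so just after the
    maximum it is the condition \<open>f i \<le> d\<close> that fails.\<close>
  let ?S = "{i. d - B \<le> i + B \<and> f i \<le> d}"
  have "i \<in> {d - 2 * B..d + B}" if "i \<in> ?S" for i using bound[of i] that by auto
  then have fin: "finite ?S" by (meson finite_atLeastAtMost_int finite_subset subsetI)
  have "B \<ge> 0" using bound[of 0] by linarith
  have "d - B \<in> ?S" using bound[of "d - B"] \<open>B \<ge> 0\<close> by auto
  then have ne: "?S \<noteq> {}" by blast
  define i where "i = Max ?S"
  have "i \<in> ?S" unfolding i_def using Max_in[OF fin ne] .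
  moreover have "i + 1 \<notin> ?S" using Max_ge[OF fin, of "i + 1"] by (auto simp: i_def)
  ultimately have "f i \<le> d" "f (i + 1) > d" by auto
  then have "f i = d" using step[of i] parity[of i] parity[of "i + 1"] by presburger
  then show "{i. f i = d} \<noteq> {}" by blast
qed

lemma admissible_boundary_bounded:
  assumes "admissible_boundary \<kappa>"
  obtains B where "\<And>i. \<bar>\<kappa> 1 i\<bar> \<le> B"
proof -
  obtain c Jm Jp where c: "\<And>i. i < Jm \<or> i > Jp \<Longrightarrow> \<kappa> 1 i = c + (1 + i) mod 2"
    using assms unfolding admissible_boundary_def by fastforce
  define B where "B = Max (insert (\<bar>c\<bar> + 1) ((\<lambda>i. \<bar>\<kappa> 1 i\<bar>) ` {Jm..Jp}))"
  have "\<bar>\<kappa> 1 i\<bar> \<le> B" for i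
  proof (cases "i \<in> {Jm..Jp}")
    case True
    then show ?thesis unfolding B_def by (intro Max_ge) auto
  next
    case False
    then have "\<kappa> 1 i = c + (1 + i) mod 2" using c by force
    then have "\<bar>\<kappa> 1 i\<bar> \<le> \<bar>c\<bar> + 1" by presburger
    also have "\<bar>c\<bar> + 1 \<le> B" unfolding B_def by (intro Max_ge) auto
    finally show ?thesis .
  qed
  then show thesis using that by blast
qed

text \<open>The delicate places are the ends. Row 2 of the tent lies one below row 1, so right next
  to an end column it has the height of row 1 in that column. The unchanged row 2 there differs from
  this height by 1.\<close>

lemma step_boundary_tent:
  assumes "step_boundary \<kappa>" and "even (1 + j + k)" and "j0 < j" "j < j1"
    and "\<kappa> 1 j0 = k - \<bar>j0 - j\<bar>" "\<kappa> 1 j1 = k - \<bar>j1 - j\<bar>"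
  defines "\<kappa>' \<equiv> (\<lambda>\<alpha> i. if i \<in> {j0<..<j1} then k - \<bar>i - j\<bar> - (int \<alpha> - 1) else \<kappa> \<alpha> i)"
  shows "step_boundary \<kappa>'"
proof -
  have twist: "\<bar>\<kappa>' 2 i - \<kappa>' 1 i\<bar> = 1" for i
    using step_boundaryD(3)[OF assms(1), of i] by (simp add: \<kappa>'_def)
  have "even (1 + i + \<kappa>' 1 i) \<and> even (2 + i + \<kappa>' 2 i)" for i
  proof (cases "i \<in> {j0<..<j1}")
    case True
    then have "\<kappa>' 1 i = k - \<bar>i - j\<bar>" "\<kappa>' 2 i = k - \<bar>i - j\<bar> - 1" by (simp_all add: \<kappa>'_def)
    then show ?thesis using assms(2) by presburger
  next
    case False
    then have "\<kappa>' \<alpha> i = \<kappa> \<alpha> i" for \<alpha> by (simp only: \<kappa>'_def if_False)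
    then show ?thesis using step_boundaryD(1,2)[OF assms(1), of i] by simp
  qed
  moreover note twist
  moreover have "\<bar>\<kappa>' 1 (i + 1) - \<kappa>' 1 i\<bar> = 1 \<and> \<bar>\<kappa>' 2 (i + 1) - \<kappa>' 2 i\<bar> = 1" for i
  proof -
    consider "i = j0" | "i + 1 = j1" | "i \<in> {j0<..<j1}" "i + 1 \<in> {j0<..<j1}"
      | "i \<notin> {j0<..<j1}" "i + 1 \<notin> {j0<..<j1}"
      by fastforce
    then show ?thesis
    proof cases
      case 1
      have "\<kappa>' 1 (i + 1) = k - (j - j0 - 1)" "\<kappa>' 2 (i + 1) = k - (j - j0 - 1) - 1"
        "\<kappa>' 1 i = k - (j - j0)" "\<kappa>' 2 i = \<kappa> 2 i"
        using 1 assms(3-5) by (simp_all add: \<kappa>'_def)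
      moreover have "\<bar>\<kappa>' 2 i - \<kappa>' 1 i\<bar> = 1" using twist .
      ultimately show ?thesis by linarith
    next
      case 2
      have "\<kappa>' 1 i = k - (j1 - j - 1)" "\<kappa>' 2 i = k - (j1 - j - 1) - 1"
        "\<kappa>' 1 (i + 1) = k - (j1 - j)" "\<kappa>' 2 (i + 1) = \<kappa> 2 (i + 1)"
        using 2[symmetric] assms(3,4,6) by (simp_all add: \<kappa>'_def)
      moreover have "\<bar>\<kappa>' 2 (i + 1) - \<kappa>' 1 (i + 1)\<bar> = 1" using twist .
      ultimately show ?thesis by linarith
    next
      case 3
      have "\<bar>\<bar>i - j\<bar> - \<bar>i + 1 - j\<bar>\<bar> = 1" by arith
      then show ?thesis using 3 by (simp add: \<kappa>'_def)
    next
      case 4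
      then have "\<kappa>' \<alpha> i = \<kappa> \<alpha> i" "\<kappa>' \<alpha> (i + 1) = \<kappa> \<alpha> (i + 1)" for \<alpha>
        by (simp_all only: \<kappa>'_def if_False)
      then show ?thesis using step_boundaryD(4,5)[OF assms(1), of i] by simp
    qed
  qed
  ultimately show ?thesis by (simp add: step_boundary_def)
qed

section \<open>From the given boundary to the tent with apex (1, j, k)\<close>

theorem mainTheorem4:
  fixes \<kappa> :: "nat \<Rightarrow> int \<Rightarrow> int"
    and T :: "nat \<Rightarrow> int \<Rightarrow> int \<Rightarrow> ratfun"
    and \<delta> :: "int \<Rightarrow> diagonal"
    and j k j0 j1 :: int
  assumes "admissible_boundary \<kappa>"
    and "A2_T_system T"
    and "\<And>\<alpha> i. \<alpha> \<in> {1, 2} \<Longrightarrow> T \<alpha> i (\<kappa> \<alpha> i) = bvar \<alpha> i"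
    and "\<And>t. admissible_diagonal \<kappa> t (\<delta> t)"
    and "even (1 + j + k)" and "k > \<kappa> 1 j"
    and "j0 = Max {i. i - \<kappa> 1 i = j - k}"
    and "j1 = Min {i. i + \<kappa> 1 i = j + k}"
  shows "T 1 j k = T 1 j1 (\<kappa> 1 j1) * (slice_product \<kappa> T \<delta> j0 j1 $ 1 $ 1)"
proof -
  have sb: "step_boundary \<kappa>"
    using assms(1) unfolding admissible_boundary_def step_boundary_def by blast
  note parity = step_boundaryD(1)[OF sb] and step = step_boundaryD(4)[OF sb]
  obtain B where B: "\<And>i. \<bar>\<kappa> 1 i\<bar> \<le> B"
    using admissible_boundary_bounded[OF assms(1)] by blast
  have fin0: "finite {i. i - \<kappa> 1 i = j - k}" "{i. i - \<kappa> 1 i = j - k} \<noteq> {}"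
  proof -
    have "i + 1 - \<kappa> 1 (i + 1) \<le> i - \<kappa> 1 i + 2" "\<bar>i - \<kappa> 1 i - i\<bar> \<le> B"
      "even (i - \<kappa> 1 i - (j - k))" for i
      using step[of i] B[of i] parity[of i] assms(5) by (linarith, simp, presburger)
    note level = level_set_finite_nonempty[of "\<lambda>i. i - \<kappa> 1 i" B "j - k", OF this]
    show "finite {i. i - \<kappa> 1 i = j - k}" "{i. i - \<kappa> 1 i = j - k} \<noteq> {}"
      using level .
  qed
  have fin1: "finite {i. i + \<kappa> 1 i = j + k}" "{i. i + \<kappa> 1 i = j + k} \<noteq> {}"
  proof -
    have "i + 1 + \<kappa> 1 (i + 1) \<le> i + \<kappa> 1 i + 2" "\<bar>i + \<kappa> 1 i - i\<bar> \<le> B"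
      "even (i + \<kappa> 1 i - (j + k))" for i
      using step[of i] B[of i] parity[of i] assms(5) by (linarith, simp, presburger)
    note level = level_set_finite_nonempty[of "\<lambda>i. i + \<kappa> 1 i" B "j + k", OF this]
    show "finite {i. i + \<kappa> 1 i = j + k}" "{i. i + \<kappa> 1 i = j + k} \<noteq> {}"
      using level .
  qed
  have j0: "j0 - \<kappa> 1 j0 = j - k" and j1: "j1 + \<kappa> 1 j1 = j + k"
    using Max_in[OF fin0] Min_in[OF fin1] assms(7,8) by auto
  have j0_max: "i \<le> j0" if "i - \<kappa> 1 i = j - k" for i
    using Max_ge[OF fin0(1)] that assms(7) by auto
  have j1_min: "j1 \<le> i" if "i + \<kappa> 1 i = j + k" for i
    using Min_le[OF fin1(1)] that assms(8) by auto
  \<comment> \<open>Were j0 at least j, the point of the boundary over j0 would lie on the ray of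
    slope 1 from (j, k) to the right, which a boundary that is below k at j cannot reach with unit
    steps.\<close>
  have "j0 < j"
    using step_boundary_lipschitz[OF sb, of j j0] j0 assms(6) by linarith
  have "j < j1"
    using step_boundary_lipschitz[OF sb, of j1 j] j1 assms(6) by linarith
  \<comment> \<open>Unit steps from j0 and j1 keep row 1 weakly below the tent, the extremality of
    j0 and j1 excludes contact, and parity widens the gap to 2.\<close>
  have below: "\<kappa> 1 i + 2 \<le> k - \<bar>i - j\<bar>" if "j0 < i" "i < j1" for i
  proof -
    have "\<kappa> 1 i < k - \<bar>i - j\<bar>"
    proof (cases "i \<le> j")
      case True
      have "i - \<kappa> 1 i \<noteq> j - k" using j0_max[of i] that(1) by linarith
      then show ?thesis
        using True step_boundary_lipschitz[OF sb, of j0 i] that j0 by linarith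
    next
      case False
      have "i + \<kappa> 1 i \<noteq> j + k" using j1_min[of i] that(2) by linarith
      then show ?thesis
        using False step_boundary_lipschitz[OF sb, of i j1] that j1 by linarith
    qed
    then show ?thesis using parity[of i] assms(5) by presburger
  qed
  define \<kappa>' where
    "\<kappa>' = (\<lambda>\<alpha> i. if i \<in> {j0<..<j1} then k - \<bar>i - j\<bar> - (int \<alpha> - 1) else \<kappa> \<alpha> i)"
  have sb': "step_boundary \<kappa>'"
    unfolding \<kappa>'_def using \<open>j0 < j\<close> \<open>j < j1\<close> j0 j1
    by (intro step_boundary_tent sb assms(5)) auto
  obtain \<delta>' where \<delta>': "\<And>i. admissible_diagonal \<kappa>' i (\<delta>' i)"
    using admissible_diagonal_exists[OF sb'] by blast
  \<comment> \<open>For row 2 the gap of 2 is used: \<open>\<kappa> 2 i\<close> is at most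
    \<open>\<kappa> 1 i + 1\<close>, hence at most one below the tent height of row 1.\<close>
  have le: "\<kappa> \<alpha> i \<le> \<kappa>' \<alpha> i" if "\<alpha> \<in> {1, 2}" for \<alpha> i
    using that below[of i] step_boundaryD(3)[OF sb, of i] by (auto simp: \<kappa>'_def)
  have "slice_product \<kappa> T \<delta> j0 j1 = slice_product \<kappa>' T \<delta>' j0 j1 \<and>
      (\<forall>\<alpha>\<in>{1, 2}. \<forall>i. T \<alpha> i (\<kappa>' \<alpha> i) \<in> positive_ratfuns)"
    by (rule positive_ratfuns.slice_product_invariant[OF sb sb' assms(2) le _ _ assms(4) \<delta>'])
      (auto simp: \<kappa>'_def assms(3)[simplified] bvar_positive)
  then have inv: "slice_product \<kappa> T \<delta> j0 j1 = slice_product \<kappa>' T \<delta>' j0 j1"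
    and nz: "T 1 i (\<kappa>' 1 i) \<noteq> 0" for i
    using positive_ratfuns.nonzero by auto
  have tent: "\<kappa>' 1 i = k - \<bar>i - j\<bar>" if "j0 \<le> i" "i \<le> j1" for i
    using that j0 j1 \<open>j0 < j\<close> \<open>j < j1\<close> by (auto simp: \<kappa>'_def)
  have up: "\<kappa>' 1 (i + 1) = \<kappa>' 1 i + 1" if "j0 \<le> i" "i < j" for i
    using that tent[of i] tent[of "i + 1"] \<open>j < j1\<close> by linarith
  have down: "\<kappa>' 1 (i + 1) = \<kappa>' 1 i - 1" if "j \<le> i" "i < j1" for i
    using that tent[of i] tent[of "i + 1"] \<open>j0 < j\<close> by linarith
  have "slice_product \<kappa> T \<delta> j0 j1 $ 1 $ 1 = slice_product \<kappa>' T \<delta>' j j1 $ 1 $ 1"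
    unfolding inv using slice_product_up_row[of j0 j j1 \<kappa>' T \<delta>', OF _ _ up] \<open>j0 < j\<close> \<open>j < j1\<close> by simp
  also have "\<dots> = T 1 j (\<kappa>' 1 j) / T 1 j1 (\<kappa>' 1 j1)"
    using slice_product_down_column[of j j1 \<kappa>' T \<delta>' 1, OF _ down nz] \<open>j < j1\<close> by simp
  also have "\<kappa>' 1 j = k" using tent[of j] \<open>j0 < j\<close> \<open>j < j1\<close> by simp
  also have "\<kappa>' 1 j1 = \<kappa> 1 j1" by (simp add: \<kappa>'_def)
  finally show ?thesis using nz[of j1] by (simp add: \<kappa>'_def)
qed

end
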